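(* Let $n\ge 2$ be a natural number with prime factorization $n=p_1^{r_1}p_2^{r_2}\cdots p_k^{r_k}$, where $p_1,\dots,p_k$ are distinct primes, $k\ge 1$ and $r_i\ge 1$. Let $X_n$ be the unitary Cayley graph of $\mathbb{Z}_n$ and $E$ its edge set. Then $$\chi_s'(X_n)=\frac{|E|}{2^{k-1}}=\frac{n\,\phi(n)}{2^{k}},$$ where $\phi$ is Euler's totient function.
   Context: A strong edge coloring of a simple graph $G$ is a proper edge coloring in which every color class is an induced matching (equivalently, two edges receive different colors whenever they share a vertex or some edge joins an endpoint of one to an endpoint of the other). The strong chromatic index $\chi_s'(G)$ is the minimum number of colors in a strong edge coloring of $G$. Let $U_n=\{m\in\mathbb{Z}_n : \gcd(m,n)=1\}$. The unitary Cayley graph $X_n=\mathrm{Cay}(\mathbb{Z}_n,U_n)$ has vertex set $\mathbb{Z}_n$, with $u$ and $v$ adjacent iff $u-v\in U_n$; it is a $\phi(n)$-regular graph with $n\phi(n)/2$ edges. *)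

theory Defs
  imports "HOL-Number_Theory.Number_Theory"
begin

text \<open>
  A simple graph is given by a vertex set and an edge set, edges being 2-element sets of vertices.
\<close>

definition simple_graph :: "'a set \<Rightarrow> 'a set set \<Rightarrow> bool" where
  "simple_graph V E \<longleftrightarrow> (\<forall>e\<in>E. e \<subseteq> V \<and> card e = 2)"

definition matching :: "'a set set \<Rightarrow> 'a set set \<Rightarrow> bool" where
  "matching E M \<longleftrightarrow> M \<subseteq> E \<and> (\<forall>e\<in>M. \<forall>f\<in>M. e \<noteq> f \<longrightarrow> e \<inter> f = {})"

text \<open>\<open>{e \<in> E. e \<subseteq> \<Union>M}\<close> is the edge set of the subgraph induced by the vertices that \<open>M\<close> covers.\<close>

definition induced_matching :: "'a set set \<Rightarrow> 'a set set \<Rightarrow> bool" where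
  "induced_matching E M \<longleftrightarrow> matching E M \<and> {e \<in> E. e \<subseteq> \<Union>M} = M"

definition proper_edge_coloring :: "'a set set \<Rightarrow> ('a set \<Rightarrow> 'c) \<Rightarrow> bool" where
  "proper_edge_coloring E c \<longleftrightarrow>
     (\<forall>e\<in>E. \<forall>f\<in>E. e \<noteq> f \<longrightarrow> e \<inter> f \<noteq> {} \<longrightarrow> c e \<noteq> c f)"

definition strong_edge_coloring :: "'a set set \<Rightarrow> ('a set \<Rightarrow> 'c) \<Rightarrow> bool" where
  "strong_edge_coloring E c \<longleftrightarrow>
     proper_edge_coloring E c \<and> (\<forall>i. induced_matching E {e \<in> E. c e = i})"

definition strong_chromatic_index :: "'a set set \<Rightarrow> nat" where
  "strong_chromatic_index E =
     (LEAST q. \<exists>c :: 'a set \<Rightarrow> nat. strong_edge_coloring E c \<and> c ` E \<subseteq> {..<q})"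

lemma strong_edge_coloring_iff:
  assumes "simple_graph V E"
  shows "strong_edge_coloring E c \<longleftrightarrow>
    (\<forall>e\<in>E. \<forall>f\<in>E. e \<noteq> f \<longrightarrow>
       (e \<inter> f \<noteq> {} \<or> (\<exists>u\<in>e. \<exists>v\<in>f. {u, v} \<in> E)) \<longrightarrow> c e \<noteq> c f)"
    (is "?L \<longleftrightarrow> ?R")
proof
  assume L: ?L
  show ?R
  proof (intro ballI impI notI)
    fix e f
    assume ef: "e \<in> E" "f \<in> E" "e \<noteq> f" and ceq: "c e = c f"
      and adj: "e \<inter> f \<noteq> {} \<or> (\<exists>u\<in>e. \<exists>v\<in>f. {u, v} \<in> E)"
    let ?M = "{g \<in> E. c g = c e}"
    have M: "e \<in> ?M" "f \<in> ?M" using ef ceq by auto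
    have im: "induced_matching E ?M" using L by (simp add: strong_edge_coloring_def)
    have dis: "g \<inter> h = {}" if "g \<in> ?M" "h \<in> ?M" "g \<noteq> h" for g h
      using im that by (simp add: induced_matching_def matching_def)
    obtain u v where uv: "u \<in> e" "v \<in> f" "{u, v} \<in> E" using adj dis[OF M ef(3)] by blast
    have "{u, v} \<subseteq> \<Union>?M" using uv M by blast
    moreover have "{g \<in> E. g \<subseteq> \<Union>?M} = ?M" using im by (simp add: induced_matching_def)
    ultimately have uvM: "{u, v} \<in> ?M" using uv(3) by blast
    have "{u, v} = e" using dis[OF uvM M(1)] uv(1) by blast
    moreover have "{u, v} = f" using dis[OF uvM M(2)] uv(2) by blast
    ultimately show False using ef by simp
  qed
next
  assume R: ?R
  have "induced_matching E {e \<in> E. c e = i}" (is "induced_matching E ?M") for i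
  proof -
    have "matching E ?M"
      unfolding matching_def
    proof (intro conjI ballI impI)
      fix e f
      assume "e \<in> ?M" "f \<in> ?M" "e \<noteq> f"
      then have "e \<in> E" "f \<in> E" "e \<noteq> f" "c e = c f" by auto
      with R show "e \<inter> f = {}" by metis
    qed auto
    moreover have "g \<in> ?M" if g: "g \<in> E" "g \<subseteq> \<Union>?M" for g
    proof -
      obtain u v where uv: "g = {u, v}"
        using assms g unfolding simple_graph_def by (meson card_2_iff)
      obtain e f where ef: "e \<in> ?M" "u \<in> e" "f \<in> ?M" "v \<in> f" using g uv by blast
      have "{u, v} \<in> E" using g uv by simp
      hence "\<exists>u\<in>e. \<exists>v\<in>f. {u, v} \<in> E" using ef by blast
      moreover have "e \<in> E" "f \<in> E" "c e = c f" using ef by auto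
      ultimately have "e = f" using R by metis
      hence "g \<subseteq> e" using ef uv by blast
      moreover have "card e = 2" "card g = 2" using assms ef g by (auto simp: simple_graph_def)
      ultimately have "g = e" by (metis card_ge_0_finite card_subset_eq zero_less_numeral)
      thus ?thesis using ef by simp
    qed
    moreover have "?M \<subseteq> {g \<in> E. g \<subseteq> \<Union>?M}" by auto
    ultimately have "{g \<in> E. g \<subseteq> \<Union>?M} = ?M" by blast
    with \<open>matching E ?M\<close> show ?thesis by (simp add: induced_matching_def)
  qed
  moreover have "proper_edge_coloring E c" using R by (simp add: proper_edge_coloring_def)
  ultimately show ?L by (simp add: strong_edge_coloring_def)
qed

text \<open>
  For finite edge sets the minimum defining the strong chromatic index is attained:
  giving all edges different colors is a strong edge coloring.
\<close>

lemma strong_chromatic_index_attained: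
  assumes "simple_graph V E" "finite E"
  shows "\<exists>c :: 'a set \<Rightarrow> nat. strong_edge_coloring (E :: 'a set set) c \<and>
           c ` E \<subseteq> {..<strong_chromatic_index E}"
proof -
  obtain c :: "'a set \<Rightarrow> nat" and m where c: "c ` E = {i. i < m}" "inj_on c E"
    using finite_imp_inj_to_nat_seg[OF assms(2)] by blast
  have "strong_edge_coloring E c"
    unfolding strong_edge_coloring_iff[OF assms(1)] using c(2) by (metis inj_onD)
  moreover have "c ` E \<subseteq> {..<m}" using c by auto
  ultimately show ?thesis
    unfolding strong_chromatic_index_def
    by (intro LeastI_ex[where P = "\<lambda>q. \<exists>c :: 'a set \<Rightarrow> nat.
          strong_edge_coloring E c \<and> c ` E \<subseteq> {..<q}"]) metis
qed

definition cayley_edges :: "('a, 'b) ring_scheme \<Rightarrow> 'a set \<Rightarrow> 'a set set" where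
  "cayley_edges G S =
     {{u, v} | u v. u \<in> carrier G \<and> v \<in> carrier G \<and> u \<ominus>\<^bsub>G\<^esub> v \<in> S}"

definition unit_residues :: "nat \<Rightarrow> int set" where
  "unit_residues n = {m \<in> carrier (residue_ring (int n)). gcd m (int n) = 1}"

definition unitary_cayley_edges :: "nat \<Rightarrow> int set set" where
  "unitary_cayley_edges n = cayley_edges (residue_ring (int n)) (unit_residues n)"

lemma mem_unitary_cayley_edges_iff:
  assumes "n \<ge> 2" "u \<in> {0..<int n}" "v \<in> {0..<int n}"
  shows "{u, v} \<in> unitary_cayley_edges n \<longleftrightarrow> gcd (u - v) (int n) = 1"
proof -
  interpret residues "int n" "residue_ring (int n)"
    using assms(1) by unfold_locales auto
  have diff: "a \<ominus>\<^bsub>residue_ring (int n)\<^esub> b = (a - b) mod int n" for a b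
    by (simp add: a_minus_def res_neg_eq res_add_eq mod_simps)
  have U: "(a - b) mod int n \<in> unit_residues n \<longleftrightarrow> gcd (a - b) (int n) = 1" for a b
    using assms(1) by (simp add: unit_residues_def res_carrier_eq)
  have sym: "gcd (v - u) (int n) = gcd (u - v) (int n)"
    by (metis gcd_neg1_int minus_diff_eq)
  have "u \<in> carrier (residue_ring (int n))" "v \<in> carrier (residue_ring (int n))"
    using assms by (simp_all add: res_carrier_eq)
  then have "{u, v} \<in> unitary_cayley_edges n \<longleftrightarrow>
      gcd (u - v) (int n) = 1 \<or> gcd (v - u) (int n) = 1"
    unfolding unitary_cayley_edges_def cayley_edges_def mem_Collect_eq diff U doubleton_eq_iff
    by metis
  then show ?thesis unfolding sym by simp
qed

lemma simple_graph_unitary_cayley: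
  assumes "n \<ge> 2"
  shows "simple_graph {0..<int n} (unitary_cayley_edges n)"
proof -
  interpret residues "int n" "residue_ring (int n)"
    using assms by unfold_locales auto
  have "e \<subseteq> {0..<int n} \<and> card e = 2" if e: "e \<in> unitary_cayley_edges n" for e
  proof -
    obtain u v where uv: "e = {u, v}" "u \<in> {0..<int n}" "v \<in> {0..<int n}"
      using e atLeastLessThanPlusOne_atLeastAtMost_int[of 0 "int n - 1"]
      unfolding unitary_cayley_edges_def cayley_edges_def res_carrier_eq by auto
    have "gcd (u - v) (int n) = 1"
      using e uv mem_unitary_cayley_edges_iff[OF assms] by simp
    hence "u \<noteq> v" using assms by auto
    thus ?thesis using uv by auto
  qed
  thus ?thesis by (simp add: simple_graph_def)
qed

end

theory Submission
  imports Defs "HOL-Library.Function_Algebras"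
begin

text \<open>
  Let \<open>q\<^sub>i = p\<^sub>i ^ r\<^sub>i\<close>. Lower bound: both orientations of the edges of an induced matching \<open>M\<close> give
  \<open>2 * card M\<close> pairs \<open>(x\<^sub>s, y\<^sub>s)\<close> such that \<open>x\<^sub>s - y\<^sub>t\<close> is a unit exactly when \<open>s = t\<close>. Taking residues
  modulo the \<open>p\<^sub>i\<close> as real numbers, the multilinear polynomials \<open>\<Prod>i. (z\<^sub>i - y\<^sub>t\<^sub>i)\<close> are nonzero at \<open>x\<^sub>s\<close>
  exactly when \<open>s = t\<close>, so they are linearly independent in a space of dimension \<open>2 ^ k\<close>, and
  \<open>card M \<le> 2 ^ (k - 1)\<close>.

  Upper bound: color an edge \<open>{x, y}\<close> by the tuple of its reductions \<open>{x mod q\<^sub>i, y mod q\<^sub>i}\<close>. Two edges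
  of the same color that touch or are joined by an edge coincide by the Chinese remainder theorem.
  The reductions are edges of the graphs of the \<open>q\<^sub>i\<close>, so \<open>\<Prod>i. q\<^sub>i \<phi>(q\<^sub>i) / 2 = n \<phi>(n) / 2 ^ k\<close> colors suffice.
\<close>

section \<open>Skew pairs of points and orientations of edges\<close>

lemma skew_pairs_card_le:
  fixes X Y :: "'a \<Rightarrow> 'i \<Rightarrow> real"
  assumes fin: "finite I" "finite D"
    and diag: "\<And>s i. s \<in> D \<Longrightarrow> i \<in> I \<Longrightarrow> X s i \<noteq> Y s i"
    and off: "\<And>s t. s \<in> D \<Longrightarrow> t \<in> D \<Longrightarrow> s \<noteq> t \<Longrightarrow> \<exists>i\<in>I. X s i = Y t i"
  shows "card D \<le> 2 ^ card I"
proof -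
  \<comment> \<open>Functions already carry pointwise addition; \<open>scale\<close> completes the
    real vector space structure.\<close>
  define scale :: "real \<Rightarrow> (('i \<Rightarrow> real) \<Rightarrow> real) \<Rightarrow> ('i \<Rightarrow> real) \<Rightarrow> real"
    where "scale a f = (\<lambda>x. a * f x)" for a f
  interpret V: vector_space scale
    by unfold_locales (simp_all add: scale_def fun_eq_iff distrib_left distrib_right)
  have sum_apply: "(\<Sum>v\<in>A. g v) x = (\<Sum>v\<in>A. g v x)"
    for A :: "'b set" and g :: "'b \<Rightarrow> ('i \<Rightarrow> real) \<Rightarrow> real" and x
    by (induction A rule: infinite_finite_induct) auto
  define F :: "'a \<Rightarrow> ('i \<Rightarrow> real) \<Rightarrow> real" where "F t = (\<lambda>z. \<Prod>i\<in>I. z i - Y t i)" for t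
  define monom :: "'i set \<Rightarrow> ('i \<Rightarrow> real) \<Rightarrow> real" where "monom S = (\<lambda>z. \<Prod>i\<in>S. z i)" for S
  have F_diag: "F s (X s) \<noteq> 0" if "s \<in> D" for s
    using diag[OF that] fin by (simp add: F_def)
  have F_off: "F t (X s) = 0" if "s \<in> D" "t \<in> D" "s \<noteq> t" for s t
    using off[OF that] fin by (auto simp: F_def)
  have inj: "inj_on F D"
    by (rule inj_onI) (metis F_diag F_off)
  \<comment> \<open>Evaluating a vanishing combination at \<open>X s\<close> kills every term except
    that of \<open>F s\<close>.\<close>
  have zero: "\<forall>v\<in>F ` D. f v = 0" if sum0: "(\<Sum>v\<in>F ` D. scale (f v) v) = 0" for f
  proof
    fix v assume "v \<in> F ` D"
    then obtain s where s: "s \<in> D" "v = F s" by auto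
    have "0 = (\<Sum>w\<in>F ` D. f w * w (X s))"
      using fun_cong[OF sum0, of "X s"] by (simp add: sum_apply scale_def)
    also have "\<dots> = (\<Sum>w\<in>{v}. f w * w (X s))"
      using s fin F_off by (intro sum.mono_neutral_right) auto
    finally show "f v = 0" using F_diag[OF s(1)] s(2) by simp
  qed
  have "V.independent (F ` D)"
    using fin(2) zero by (intro V.independent_if_scalars_zero) blast+
  moreover have "F ` D \<subseteq> V.span (monom ` Pow I)"
  proof
    fix v assume "v \<in> F ` D"
    then obtain t where v: "v = F t" by auto
    \<comment> \<open>In the expanded product, \<open>S\<close> collects the factors that contribute
      \<open>z i\<close> rather than \<open>- Y t i\<close>.\<close>
    have "v = (\<Sum>S\<in>Pow I. scale (\<Prod>i\<in>I - S. - Y t i) (monom S))"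
    proof
      fix z
      have "v z = (\<Prod>i\<in>I. z i + - Y t i)" by (simp add: v F_def)
      also have "\<dots> = (\<Sum>S\<in>Pow I. (\<Prod>i\<in>S. z i) * (\<Prod>i\<in>I - S. - Y t i))"
        using fin(1) by (rule prod_add)
      finally show "v z = (\<Sum>S\<in>Pow I. scale (\<Prod>i\<in>I - S. - Y t i) (monom S)) z"
        unfolding sum_apply scale_def monom_def by (simp only: mult.commute)
    qed
    also have "\<dots> \<in> V.span (monom ` Pow I)"
      by (intro V.span_sum V.span_scale V.span_base) auto
    finally show "v \<in> V.span (monom ` Pow I)" .
  qed
  ultimately have "card (F ` D) \<le> card (monom ` Pow I)"
    using V.independent_span_bound[of "monom ` Pow I" "F ` D"] fin(1) by simp
  also have "\<dots> \<le> card (Pow I)" using fin(1) by (intro card_image_le) simp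
  finally show ?thesis using inj fin by (simp add: card_image card_Pow)
qed

text \<open>An edge has exactly two orientations. Ordered pairs serve both as skew pairs for a
  matching and for counting all edges by degrees.\<close>

lemma card_darts:
  assumes "finite M" and "\<And>e. e \<in> M \<Longrightarrow> card e = 2"
  shows "finite {(x, y). {x, y} \<in> M}" "card {(x, y). {x, y} \<in> M} = 2 * card M"
proof -
  let ?D = "\<lambda>e. {(x, y). {x, y} = e}"
  have D: "finite (?D e) \<and> card (?D e) = 2" if e: "e \<in> M" for e
  proof -
    obtain u v where uv: "e = {u, v}" "u \<noteq> v" using assms(2)[OF e] by (meson card_2_iff)
    have "?D e = {(u, v), (v, u)}" using uv by (auto simp: doubleton_eq_iff)
    then show ?thesis using uv by simp
  qed
  have eq: "{(x, y). {x, y} \<in> M} = (\<Union>e\<in>M. ?D e)" by auto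
  show "finite {(x, y). {x, y} \<in> M}" unfolding eq using assms(1) D by blast
  have "card (\<Union>e\<in>M. ?D e) = (\<Sum>e\<in>M. card (?D e))"
    using assms(1) D by (intro card_UN_disjoint) auto
  also have "\<dots> = 2 * card M" using D by simp
  finally show "card {(x, y). {x, y} \<in> M} = 2 * card M" unfolding eq .
qed

section \<open>Edges of the unitary Cayley graph and their number\<close>

lemma unitary_cayley_edgeE:
  assumes "n \<ge> 2" "e \<in> unitary_cayley_edges n"
  obtains x y where "e = {x, y}" "x \<in> {0..<int n}" "y \<in> {0..<int n}" "coprime (x - y) (int n)"
proof -
  obtain x y where e: "e = {x, y}" "x \<in> {0..<int n}" "y \<in> {0..<int n}"
    using simple_graph_unitary_cayley[OF assms(1)] assms(2)
    unfolding simple_graph_def by (metis card_2_iff insert_subset)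
  moreover have "coprime (x - y) (int n)"
    using assms e mem_unitary_cayley_edges_iff by (simp add: coprime_iff_gcd_eq_1)
  ultimately show ?thesis using that by blast
qed

lemma doubleton_mem_unitary_cayley_iff:
  assumes "n \<ge> 2"
  shows "{x, y} \<in> unitary_cayley_edges n \<longleftrightarrow>
    x \<in> {0..<int n} \<and> y \<in> {0..<int n} \<and> coprime (x - y) (int n)"
proof
  assume e: "{x, y} \<in> unitary_cayley_edges n"
  then have "{x, y} \<subseteq> {0..<int n}"
    using simple_graph_unitary_cayley[OF assms] unfolding simple_graph_def by blast
  then show "x \<in> {0..<int n} \<and> y \<in> {0..<int n} \<and> coprime (x - y) (int n)"
    using e mem_unitary_cayley_edges_iff[OF assms] by (simp add: coprime_iff_gcd_eq_1)
qed (use mem_unitary_cayley_edges_iff[OF assms] in \<open>simp add: coprime_iff_gcd_eq_1\<close>)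

lemma finite_unitary_cayley_edges:
  assumes "n \<ge> 2"
  shows "finite (unitary_cayley_edges n)"
proof (rule finite_subset)
  show "unitary_cayley_edges n \<subseteq> Pow {0..<int n}"
    using simple_graph_unitary_cayley[OF assms] by (auto simp: simple_graph_def)
qed simp

text \<open>Reducing \<open>x - y\<close> modulo \<open>n\<close> preserves coprimality to
  \<open>n\<close>, so neighbours \<open>y\<close> of \<open>x\<close> correspond to
  totatives.\<close>

lemma card_coprime_diff:
  assumes "n \<ge> 2"
  shows "card {y \<in> {0..<int n}. coprime (x - y) (int n)} = totient n"
proof -
  let ?N = "{y \<in> {0..<int n}. coprime (x - y) (int n)}"
  let ?f = "\<lambda>m. (x - int m) mod int n"
  have cop: "coprime (int m) (int n) \<longleftrightarrow> coprime (x - (x - int m) mod int n) (int n)" for m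
  proof -
    have "(x - (x - int m) mod int n) mod int n = int m mod int n"
      by (simp add: mod_simps)
    then show ?thesis using assms by (metis coprime_mod_left_iff of_nat_eq_0_iff not_numeral_le_zero)
  qed
  have "bij_betw ?f (totatives n) ?N"
  proof (rule bij_betw_byWitness[where f' = "\<lambda>y. nat ((x - y) mod int n)"])
    \<comment> \<open>A totative may equal its modulus only for modulus 1, so here reduction modulo
      \<open>n\<close> fixes \<open>m\<close>.\<close>
    have lt: "m < n" if "m \<in> totatives n" for m
      using that assms totatives_less by auto
    show "\<forall>m\<in>totatives n. nat ((x - ?f m) mod int n) = m"
      using lt by (simp add: mod_simps)
    show "\<forall>y\<in>?N. ?f (nat ((x - y) mod int n)) = y"
      using assms by (simp add: mod_simps)
    show "?f ` totatives n \<subseteq> ?N"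
      using assms cop by (auto simp: totatives_def)
    show "(\<lambda>y. nat ((x - y) mod int n)) ` ?N \<subseteq> totatives n"
    proof safe
      fix y assume y: "coprime (x - y) (int n)"
      let ?m = "nat ((x - y) mod int n)"
      have m: "int ?m = (x - y) mod int n" using assms by simp
      have "coprime (int ?m) (int n)" using y assms by (simp add: m)
      then have "coprime ?m n" by (simp only: coprime_int_iff)
      moreover have "?m > 0" using calculation assms by (cases "?m = 0") auto
      moreover have "?m \<le> n"
        using assms m pos_mod_bound[of "int n" "x - y"] by linarith
      ultimately show "?m \<in> totatives n" by (simp add: totatives_def)
    qed
  qed
  then show ?thesis by (simp add: bij_betw_same_card totient_def)
qed

lemma card_unitary_cayley_edges:
  assumes "n \<ge> 2"
  shows "2 * card (unitary_cayley_edges n) = n * totient n"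
proof -
  let ?E = "unitary_cayley_edges n"
  have "2 * card ?E = card {(x, y). {x, y} \<in> ?E}"
    using card_darts(2)[OF finite_unitary_cayley_edges[OF assms]]
      simple_graph_unitary_cayley[OF assms] by (simp add: simple_graph_def)
  also have "{(x, y). {x, y} \<in> ?E} =
      (SIGMA x:{0..<int n}. {y \<in> {0..<int n}. coprime (x - y) (int n)})"
    by (auto simp: doubleton_mem_unitary_cayley_iff[OF assms])
  also have "card \<dots> = n * totient n"
    by (subst card_SigmaI) (simp_all add: card_coprime_diff[OF assms] del: atLeastLessThan_iff)
  finally show ?thesis .
qed

text \<open>Coprimality passes to divisors and survives reduction. This keeps the palette of the
  coloring small.\<close>

lemma mod_image_unitary_cayley_edge:
  assumes "n \<ge> 2" "q \<ge> 2" "q dvd n" "e \<in> unitary_cayley_edges n"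
  shows "(\<lambda>x. x mod int q) ` e \<in> unitary_cayley_edges q"
proof -
  obtain x y where e: "e = {x, y}" "coprime (x - y) (int n)"
    using unitary_cayley_edgeE[OF assms(1,4)] .
  have "coprime (x - y) (int q)"
    using e(2) assms(3) by (meson coprime_divisors dvd_refl int_dvd_int_iff)
  then have "coprime ((x mod int q - y mod int q) mod int q) (int q)"
    using assms(2) by (simp add: mod_diff_eq)
  then have "coprime (x mod int q - y mod int q) (int q)"
    using assms(2) by simp
  then show ?thesis
    using assms(2) by (simp add: e(1) doubleton_mem_unitary_cayley_iff)
qed

section \<open>Residue coordinates modulo the prime powers\<close>

locale prime_power_factorization =
  fixes n :: nat and I :: "'i set" and p r :: "'i \<Rightarrow> nat"
  assumes n_ge_2: "n \<ge> 2"
    and fin: "finite I"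
    and prime: "\<And>i. i \<in> I \<Longrightarrow> prime (p i)"
    and inj: "inj_on p I"
    and r_pos: "\<And>i. i \<in> I \<Longrightarrow> r i \<ge> 1"
    and n_eq: "n = (\<Prod>i\<in>I. p i ^ r i)"
begin

abbreviation q :: "'i \<Rightarrow> nat" where "q i \<equiv> p i ^ r i"

lemma p_dvd_q: "i \<in> I \<Longrightarrow> p i dvd q i"
  using r_pos[of i] by (auto intro: dvd_power)

lemma q_dvd_n: "i \<in> I \<Longrightarrow> q i dvd n"
  unfolding n_eq using fin by (rule dvd_prodI)

lemma q_ge_2: "i \<in> I \<Longrightarrow> q i \<ge> 2"
  using p_dvd_q[of i] prime[of i] prime_ge_2_nat[of "p i"]
  by (meson dvd_imp_le le_trans prime_gt_0_nat zero_less_power)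

lemma coprime_q: "i \<in> I \<Longrightarrow> j \<in> I \<Longrightarrow> i \<noteq> j \<Longrightarrow> coprime (q i) (q j)"
  using prime inj by (auto intro!: primes_coprime simp: inj_on_def)

text \<open>A power is coprime to the same integers as its base, and a prime to all that it does not
  divide; hence the exponents do not affect adjacency.\<close>

lemma coprime_n_iff: "coprime a (int n) \<longleftrightarrow> (\<forall>i\<in>I. a mod int (p i) \<noteq> 0)"
proof -
  have "coprime a (int n) \<longleftrightarrow> (\<forall>i\<in>I. coprime a (int (q i)))"
    unfolding n_eq of_nat_prod using fin by (induction rule: finite_induct) auto
  also have "\<dots> \<longleftrightarrow> (\<forall>i\<in>I. coprime a (int (p i)))"
    by (intro ball_cong) (auto dest!: r_pos)
  also have "\<dots> \<longleftrightarrow> (\<forall>i\<in>I. a mod int (p i) \<noteq> 0)"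
  proof (intro ball_cong refl)
    fix i assume "i \<in> I"
    then have "prime (int (p i))" using prime by simp
    then show "coprime a (int (p i)) \<longleftrightarrow> a mod int (p i) \<noteq> 0"
      by (metis coprime_commute coprime_absorb_left dvd_eq_mod_eq_0 not_prime_unit prime_imp_coprime)
  qed
  finally show ?thesis .
qed

lemma coprime_diff_iff:
  "coprime (x - y) (int n) \<longleftrightarrow> (\<forall>i\<in>I. x mod int (p i) \<noteq> y mod int (p i))"
  unfolding coprime_n_iff mod_eq_dvd_iff dvd_eq_mod_eq_0 by (rule refl)

lemma mod_q_neq:
  assumes "coprime (x - y) (int n)" "i \<in> I"
  shows "x mod int (q i) \<noteq> y mod int (q i)"
proof
  assume "x mod int (q i) = y mod int (q i)"
  then have "x mod int (p i) = y mod int (p i)"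
    using p_dvd_q[OF assms(2)] by (metis int_dvd_int_iff mod_mod_cancel)
  then show False using assms coprime_diff_iff by blast
qed

text \<open>Uniqueness in the Chinese remainder theorem for the pairwise coprime
  \<open>q i\<close>.\<close>

lemma eq_if_mod_q_eq:
  assumes "x \<in> {0..<int n}" "y \<in> {0..<int n}"
    and "\<And>i. i \<in> I \<Longrightarrow> x mod int (q i) = y mod int (q i)"
  shows "x = y"
proof -
  have "[x = y] (mod (\<Prod>i\<in>I. int (q i)))"
    using assms(3) coprime_q
    by (intro cong_cong_prod_coprime) (auto simp: cong_def coprime_int_iff simp del: of_nat_power)
  then show ?thesis using assms(1,2) by (simp add: n_eq cong_def)
qed

section \<open>Size of induced matchings\<close>

lemma card_induced_matching_le:
  assumes "induced_matching (unitary_cayley_edges n) M"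
  shows "2 * card M \<le> 2 ^ card I"
proof -
  let ?E = "unitary_cayley_edges n"
  let ?D = "{(x, y). {x, y} \<in> M}"
  have sub: "M \<subseteq> ?E" and disj: "\<And>e f. e \<in> M \<Longrightarrow> f \<in> M \<Longrightarrow> e \<noteq> f \<Longrightarrow> e \<inter> f = {}"
    and ind: "{e \<in> ?E. e \<subseteq> \<Union>M} = M"
    using assms by (auto simp: induced_matching_def matching_def)
  have finM: "finite M"
    using sub finite_unitary_cayley_edges[OF n_ge_2] finite_subset by blast
  have two: "card e = 2" if "e \<in> M" for e
    using that sub simple_graph_unitary_cayley[OF n_ge_2] by (auto simp: simple_graph_def)
  have D: "finite ?D" "card ?D = 2 * card M"
    using card_darts[OF finM two] by auto
  note mem = doubleton_mem_unitary_cayley_iff[OF n_ge_2]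
  have "card ?D \<le> 2 ^ card I"
  \<comment> \<open>Residues for different primes live in different fields; as real numbers they
    share one field, and equality is preserved.\<close>
  proof (rule skew_pairs_card_le[where
        X = "\<lambda>s i. of_int (fst s mod int (p i))" and Y = "\<lambda>s i. of_int (snd s mod int (p i))"])
    fix s i assume "s \<in> ?D" "i \<in> I"
    then show "of_int (fst s mod int (p i)) \<noteq> (of_int (snd s mod int (p i)) :: real)"
      using sub by (auto simp: mem coprime_diff_iff)
  next
    fix s t assume st: "s \<in> ?D" "t \<in> ?D" "s \<noteq> t"
    obtain x y x' y' where eq: "s = (x, y)" "t = (x', y')" by (cases s, cases t)
    have M: "{x, y} \<in> M" "{x', y'} \<in> M" using st eq by auto
    \<comment> \<open>Otherwise inducedness puts \<open>{x, y'}\<close> into \<open>M\<close>, and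
      disjointness identifies it with both edges, so \<open>s = t\<close>. The reversal of
      \<open>s\<close> is covered too.\<close>
    have "\<not> coprime (x - y') (int n)"
    proof
      assume "coprime (x - y') (int n)"
      then have "{x, y'} \<in> ?E" using M sub by (auto simp: mem)
      then have xy': "{x, y'} \<in> M" using M ind by blast
      have "{x, y'} = {x, y}" "{x, y'} = {x', y'}"
        using disj[OF xy' M(1)] disj[OF xy' M(2)] by auto
      then have "y = y'" "x = x'" by (auto simp: doubleton_eq_iff)
      then show False using st eq by simp
    qed
    then show "\<exists>i\<in>I. of_int (fst s mod int (p i)) = (of_int (snd t mod int (p i)) :: real)"
      by (simp add: eq coprime_diff_iff)
  qed (use fin D in auto)
  then show ?thesis using D by simp
qed

section \<open>The coloring by reduced edges\<close>

definition residue_edges :: "int set \<Rightarrow> 'i \<Rightarrow> int set" where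
  "residue_edges e = (\<lambda>i\<in>I. (\<lambda>x. x mod int (q i)) ` e)"

text \<open>Equal reductions alone could pair the endpoints differently in different coordinates. A
  shared vertex or a joining edge forces the same pairing in all of them, and then the Chinese
  remainder theorem gives \<open>e = f\<close>.\<close>

lemma residue_edges_neq:
  assumes e: "e \<in> unitary_cayley_edges n" and f: "f \<in> unitary_cayley_edges n" and "e \<noteq> f"
    and adj: "e \<inter> f \<noteq> {} \<or> (\<exists>u\<in>e. \<exists>v\<in>f. {u, v} \<in> unitary_cayley_edges n)"
  shows "residue_edges e \<noteq> residue_edges f"
proof
  assume eq: "residue_edges e = residue_edges f"
  obtain x y where xy: "e = {x, y}" "x \<in> {0..<int n}" "y \<in> {0..<int n}" "coprime (x - y) (int n)"
    using unitary_cayley_edgeE[OF n_ge_2 e] .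
  obtain z w where zw: "f = {z, w}" "z \<in> {0..<int n}" "w \<in> {0..<int n}" "coprime (z - w) (int n)"
    using unitary_cayley_edgeE[OF n_ge_2 f] .
  have sym: "coprime (b - a) (int n)" if "coprime (a - b) (int n)" for a b
    using that by (metis coprime_minus_left_iff minus_diff_eq)
  obtain u v where uv: "u \<in> e" "v \<in> f" "u = v \<or> coprime (u - v) (int n)"
    using adj by (auto simp: doubleton_mem_unitary_cayley_iff[OF n_ge_2])
  obtain u' where u': "e = {u, u'}" "u' \<in> {0..<int n}" "u \<in> {0..<int n}" "coprime (u - u') (int n)"
    using uv(1) xy sym by blast
  obtain v' where v': "f = {v, v'}" "v' \<in> {0..<int n}" "v \<in> {0..<int n}" "coprime (v - v') (int n)"
    using uv(2) zw sym by blast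
  have res: "{u mod int (q i), u' mod int (q i)} = {v mod int (q i), v' mod int (q i)}"
    if "i \<in> I" for i
    using fun_cong[OF eq, of i] that by (simp add: residue_edges_def u'(1) v'(1))
  from uv(3) have "e = f"
  proof
    assume uv: "u = v"
    have "u' mod int (q i) = v' mod int (q i)" if "i \<in> I" for i
      using res[OF that] unfolding uv doubleton_eq_iff by metis
    then have "u' = v'" by (rule eq_if_mod_q_eq[OF u'(2) v'(2)])
    then show ?thesis unfolding u'(1) v'(1) uv by (rule arg_cong)
  next
    assume uv: "coprime (u - v) (int n)"
    \<comment> \<open>Adjacent \<open>u\<close> and \<open>v\<close> differ modulo every
      \<open>q i\<close>, so only the crosswise pairing remains.\<close>
    have *: "u mod int (q i) = v' mod int (q i) \<and> u' mod int (q i) = v mod int (q i)"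
      if "i \<in> I" for i
      using res[OF that] mod_q_neq[OF uv that] unfolding doubleton_eq_iff by metis
    have "u = v'" using * by (intro eq_if_mod_q_eq[OF u'(3) v'(2)]) blast
    moreover have "u' = v" using * by (intro eq_if_mod_q_eq[OF u'(2) v'(3)]) blast
    ultimately show ?thesis unfolding u'(1) v'(1) by blast
  qed
  with \<open>e \<noteq> f\<close> show False ..
qed

text \<open>Being restricted to \<open>I\<close>, the tuples lie in an extensional product, which is
  finite and serves as the palette.\<close>

lemma residue_edges_in_PiE:
  assumes "e \<in> unitary_cayley_edges n"
  shows "residue_edges e \<in> (\<Pi>\<^sub>E i\<in>I. unitary_cayley_edges (q i))"
  using mod_image_unitary_cayley_edge[OF n_ge_2 q_ge_2 q_dvd_n assms]
  by (auto simp: residue_edges_def simp del: of_nat_power)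

text \<open>By multiplicativity of the totient both sides equal \<open>n * totient n\<close>; this
  makes the palette size meet the lower bound.\<close>

lemma card_edges_eq_prod:
  "2 * card (unitary_cayley_edges n) = 2 ^ card I * (\<Prod>i\<in>I. card (unitary_cayley_edges (q i)))"
proof -
  have inj_q: "inj_on q I"
  proof (rule inj_onI, rule ccontr)
    fix i j assume "i \<in> I" "j \<in> I" "q i = q j" "i \<noteq> j"
    then have "coprime (q i) (q i)" using coprime_q[of i j] by metis
    then have "q i = 1" by (simp only: coprime_self nat_dvd_1_iff_1)
    then show False using q_ge_2[OF \<open>i \<in> I\<close>] by linarith
  qed
  have pw: "pairwise coprime (q ` I)"
    by (rule pairwiseI) (use coprime_q in blast)
  have "totient (prod q I) = (\<Prod>i\<in>I. totient (q i))"
    by (rule totient_prod_coprime[OF pw inj_q])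
  then have "n * totient n = (\<Prod>i\<in>I. q i * totient (q i))"
    unfolding n_eq prod.distrib by (simp only:)
  also have "\<dots> = (\<Prod>i\<in>I. 2 * card (unitary_cayley_edges (q i)))"
    using card_unitary_cayley_edges[OF q_ge_2] by (intro prod.cong) auto
  also have "\<dots> = 2 ^ card I * (\<Prod>i\<in>I. card (unitary_cayley_edges (q i)))"
    by (simp add: prod.distrib)
  finally show ?thesis by (simp add: card_unitary_cayley_edges[OF n_ge_2])
qed

section \<open>The two bounds on the strong chromatic index\<close>

lemma strong_chromatic_index_le:
  "strong_chromatic_index (unitary_cayley_edges n) \<le> (\<Prod>i\<in>I. card (unitary_cayley_edges (q i)))"
proof -
  let ?E = "unitary_cayley_edges n"
  let ?P = "\<Pi>\<^sub>E i\<in>I. unitary_cayley_edges (q i)"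
  have finP: "finite ?P"
    using fin finite_unitary_cayley_edges q_ge_2 by (auto intro!: finite_PiE)
  \<comment> \<open>The index is defined with natural numbers as colors, so \<open>h\<close> numbers
    the tuples from 0.\<close>
  obtain h :: "('i \<Rightarrow> int set) \<Rightarrow> nat" where h: "bij_betw h ?P {0..<card ?P}"
    using ex_bij_betw_finite_nat[OF finP] by blast
  define c where "c e = h (residue_edges e)" for e
  have "strong_edge_coloring ?E c"
    unfolding strong_edge_coloring_iff[OF simple_graph_unitary_cayley[OF n_ge_2]]
  proof (intro ballI impI)
    fix e f assume ef: "e \<in> ?E" "f \<in> ?E" "e \<noteq> f"
      "e \<inter> f \<noteq> {} \<or> (\<exists>u\<in>e. \<exists>v\<in>f. {u, v} \<in> ?E)"
    then show "c e \<noteq> c f"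
      using residue_edges_neq[OF ef] inj_onD[OF bij_betw_imp_inj_on[OF h]]
        residue_edges_in_PiE[OF ef(1)] residue_edges_in_PiE[OF ef(2)]
      unfolding c_def by blast
  qed
  moreover have "c ` ?E \<subseteq> {..<card ?P}"
    using bij_betwE[OF h] residue_edges_in_PiE by (auto simp: c_def)
  ultimately have "strong_chromatic_index ?E \<le> card ?P"
    unfolding strong_chromatic_index_def by (intro Least_le) blast
  then show ?thesis using fin by (simp add: card_PiE)
qed

text \<open>The color classes of an optimal coloring are induced matchings that cover all edges.
  Doubling both sides avoids the exponent \<open>card I - 1\<close>.\<close>

lemma card_edges_le:
  "2 * card (unitary_cayley_edges n) \<le> 2 ^ card I * strong_chromatic_index (unitary_cayley_edges n)"
proof -
  let ?E = "unitary_cayley_edges n"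
  let ?\<chi> = "strong_chromatic_index ?E"
  have finE: "finite ?E" using finite_unitary_cayley_edges[OF n_ge_2] .
  obtain c :: "int set \<Rightarrow> nat" where c: "strong_edge_coloring ?E c" "c ` ?E \<subseteq> {..<?\<chi>}"
    using strong_chromatic_index_attained[OF simple_graph_unitary_cayley[OF n_ge_2] finE] by blast
  let ?M = "\<lambda>j. {e \<in> ?E. c e = j}"
  have "?E = (\<Union>j<?\<chi>. ?M j)" using c(2) by auto
  then have "card ?E \<le> (\<Sum>j<?\<chi>. card (?M j))"
    by (metis card_UN_le finite_lessThan)
  then have "2 * card ?E \<le> (\<Sum>j<?\<chi>. 2 * card (?M j))"
    by (simp add: sum_distrib_left[symmetric])
  also have "\<dots> \<le> (\<Sum>j<?\<chi>. 2 ^ card I)"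
    using c(1) by (intro sum_mono card_induced_matching_le) (simp add: strong_edge_coloring_def)
  finally show ?thesis by (simp add: mult.commute)
qed

lemma strong_chromatic_index_eq:
  "2 ^ card I * strong_chromatic_index (unitary_cayley_edges n) = 2 * card (unitary_cayley_edges n)"
proof (rule le_antisym)
  show "2 ^ card I * strong_chromatic_index (unitary_cayley_edges n)
      \<le> 2 * card (unitary_cayley_edges n)"
    unfolding card_edges_eq_prod using strong_chromatic_index_le by (rule mult_le_mono2)
qed (rule card_edges_le)

end

theorem theorem2:
  fixes n k :: nat and p r :: "nat \<Rightarrow> nat"
  assumes "n \<ge> 2"
    and "k \<ge> 1"
    and "\<And>i. i \<in> {1..k} \<Longrightarrow> prime (p i)"
    and "inj_on p {1..k}"
    and "\<And>i. i \<in> {1..k} \<Longrightarrow> r i \<ge> 1"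
    and "n = (\<Prod>i\<in>{1..k}. p i ^ r i)"
  shows "real (strong_chromatic_index (unitary_cayley_edges n))
           = real (card (unitary_cayley_edges n)) / 2 ^ (k - 1)
       \<and> real (card (unitary_cayley_edges n)) / 2 ^ (k - 1)
           = real n * real (totient n) / 2 ^ k"
proof -
  interpret prime_power_factorization n "{1..k}" p r
    using assms by unfold_locales auto
  let ?E = "unitary_cayley_edges n"
  \<comment> \<open>As \<open>k \<ge> 1\<close>, the truncated difference \<open>k - 1\<close> is
    the true predecessor.\<close>
  have two_k: "(2::real) ^ k = 2 * 2 ^ (k - 1)"
    using assms(2) by (simp add: power_eq_if)
  have "2 ^ k * strong_chromatic_index ?E = 2 * card ?E"
    using strong_chromatic_index_eq by simp
  then have "2 ^ k * real (strong_chromatic_index ?E) = 2 * real (card ?E)"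
    by (metis of_nat_mult of_nat_numeral of_nat_power)
  moreover have "2 * real (card ?E) = real n * real (totient n)"
    using card_unitary_cayley_edges[OF assms(1)] by (metis of_nat_mult of_nat_numeral)
  ultimately show ?thesis by (simp add: two_k field_simps)
qed

end
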